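(* Let $t \geq 2$ be an integer and let $G$ be a connected graph with minimum degree $\delta(G)$ and spectral radius $\rho(G)$. Then $$\mathrm{cp}^{(t)}(G)\geq\rho(G)-t+1+\left\lceil\frac{\delta(G)}{t-1}\right\rceil,$$ with equality if and only if $G$ is (isomorphic to) the block graph of a $2$-$(v,k,1)$ design, where $k=\frac{\delta(G)}{t-1}$ and $v=k|V(G)|/t$.
   Context: Graphs are finite, simple and undirected. The spectral radius $\rho(G)$ is the largest eigenvalue of the adjacency matrix of $G$. A clique in $G$ is a vertex set $Q\subseteq V(G)$ such that the subgraph induced on $Q$ is complete. A clique partition of $G$ is a set $\mathcal{Q}=\{Q_1,\ldots,Q_m\}$ of cliques such that each edge of $G$ belongs to exactly one clique of $\mathcal{Q}$; its size is the number $m$ of elements of $\mathcal{Q}$. $\mathrm{cp}^{(t)}(G)$ denotes the minimum size of a clique partition of $G$ in which every clique has at most $t$ vertices. A $2$-$(v,k,1)$ design (Steiner $2$-design) consists of $v\geq 1$ points together with a collection of blocks, each block being a subset of the point set of size $k\geq 1$, such that any two distinct points lie together in exactly one block. The degenerate case $v=k=1$ is allowed, and in that case blocks may be repeated (the single point with $t$ copies of the block consisting of that point has block graph $K_t$). The block graph of such a design is the graph whose vertices are the blocks (repeated blocks giving distinct vertices), two distinct vertices being adjacent when the corresponding blocks meet in exactly one point. *)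

theory Defs
  imports
    Complex_Main
    "Graph_Theory.Pair_Digraph"
    "Graph_Theory.Digraph_Component"
    "Graph_Theory.Digraph_Isomorphism"
    "Jordan_Normal_Form.Spectral_Radius"
begin

text \<open>
  Finite simple undirected graphs are the symmetric loop-free pair digraphs of
  \<^locale>\<open>pair_graph\<close>: an edge uv is represented by the two arcs (u,v) and (v,u), so
  the degree of a vertex is its out-degree.
\<close>

definition min_degree :: "'a pair_pre_digraph \<Rightarrow> nat" where
  "min_degree G = Min (out_degree (with_proj G) ` pverts G)"

definition adjacency_matrix :: "'a pair_pre_digraph \<Rightarrow> 'a list \<Rightarrow> real mat" where
  "adjacency_matrix G vs =
     mat (length vs) (length vs) (\<lambda>(i, j). if (vs ! i, vs ! j) \<in> parcs G then 1 else 0)"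

text \<open>
  Reordering the vertices conjugates the adjacency matrix by a permutation matrix, so the
  choice of enumeration does not affect the spectrum. The spectrum is taken over the reals,
  where the symmetric adjacency matrix has all its eigenvalues.
\<close>

definition graph_spectral_radius :: "'a pair_pre_digraph \<Rightarrow> real" where
  "graph_spectral_radius G =
     Max (spectrum (adjacency_matrix G (SOME vs. distinct vs \<and> set vs = pverts G)))"

definition clique :: "'a pair_pre_digraph \<Rightarrow> 'a set \<Rightarrow> bool" where
  "clique G Q \<longleftrightarrow> Q \<subseteq> pverts G \<and> (\<forall>u\<in>Q. \<forall>v\<in>Q. u \<noteq> v \<longrightarrow> (u, v) \<in> parcs G)"

definition clique_partition :: "'a pair_pre_digraph \<Rightarrow> 'a set set \<Rightarrow> bool" where
  "clique_partition G \<Q> \<longleftrightarrow>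
     (\<forall>Q\<in>\<Q>. clique G Q) \<and>
     (\<forall>(u, v)\<in>parcs G. \<exists>!Q. Q \<in> \<Q> \<and> u \<in> Q \<and> v \<in> Q)"

definition cp :: "nat \<Rightarrow> 'a pair_pre_digraph \<Rightarrow> nat" where
  "cp t G = (LEAST m. \<exists>\<Q>. clique_partition G \<Q> \<and> (\<forall>Q\<in>\<Q>. card Q \<le> t) \<and> card \<Q> = m)"

text \<open>
  A 2-(v,k,1) design on the point set P. The blocks are a family B indexed by I, so that
  repeated blocks have distinct indices; they are allowed only if v = k = 1.
\<close>

locale steiner_2_design =
  fixes v k :: nat and P :: "'p set" and I :: "'i set" and B :: "'i \<Rightarrow> 'p set"
  assumes finite_points: "finite P"
    and card_points: "card P = v"
    and v_pos: "v \<ge> 1"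
    and k_pos: "k \<ge> 1"
    and finite_blocks: "finite I"
    and block_points: "i \<in> I \<Longrightarrow> B i \<subseteq> P"
    and card_block: "i \<in> I \<Longrightarrow> card (B i) = k"
    and unique_block: "x \<in> P \<Longrightarrow> y \<in> P \<Longrightarrow> x \<noteq> y \<Longrightarrow> \<exists>!i. i \<in> I \<and> x \<in> B i \<and> y \<in> B i"
    and no_repeated_blocks: "inj_on B I \<or> (v = 1 \<and> k = 1)"

definition block_graph :: "'i set \<Rightarrow> ('i \<Rightarrow> 'p set) \<Rightarrow> 'i pair_pre_digraph" where
  "block_graph I B =
     \<lparr> pverts = I, parcs = {(i, j). i \<in> I \<and> j \<in> I \<and> i \<noteq> j \<and> card (B i \<inter> B j) = 1} \<rparr>"

end

theory Submission
  imports Defs "HOL-Analysis.Function_Topology"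
begin

text \<open>
  Let \<open>N\<close> be the vertex-clique incidence matrix of an optimal partition into \<open>m\<close> cliques. Then
  \<open>N N\<^sup>T\<close> is the adjacency matrix plus the diagonal matrix counting the cliques through each
  vertex, each count being at least \<open>\<lceil>\<delta> / (t - 1)\<rceil>\<close>, while \<open>N\<^sup>T N\<close> has diagonal entries at
  most \<open>t\<close> and off-diagonal entries at most \<open>1\<close>. So \<open>\<rho> + \<lceil>\<delta> / (t - 1)\<rceil> \<le> t + m - 1\<close>, by
  testing the Perron vector. As that vector is positive, equality forces all these bounds to be
  tight: any two cliques meet in one vertex, so the cliques are the points and the vertices the
  blocks of a 2-design whose block graph is the given graph. Conversely, the points of a design
  give a partition of its block graph into \<open>v = t (k - 1) + 1\<close> cliques of size \<open>t\<close>, and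
  \<open>\<rho> \<ge> \<delta> = k (t - 1)\<close>.
\<close>

section \<open>The Perron vector of a graph\<close>

text \<open>Vectors on \<open>V\<close> are encoded as total functions vanishing off
  \<open>V\<close>. The sphere is then a closed subset of a product of intervals
  \<open>{-1..1}\<close> and singletons \<open>{0}\<close>, which is compact by Tychonoff's
  theorem.\<close>

lemma compact_unit_sphere_fun:
  fixes V :: "'a set"
  assumes "finite V"
  shows "compact {x. (\<Sum>u\<in>V. (x u)\<^sup>2) = (1::real) \<and> (\<forall>u. u \<notin> V \<longrightarrow> x u = 0)}"
    (is "compact ?S")
proof -
  define K where "K = PiE UNIV (\<lambda>u. if u \<in> V then {-1..1::real} else {0})"
  have "compactin (product_topology (\<lambda>i. euclidean) UNIV) K"
    unfolding K_def compactin_PiE by simp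
  then have K: "compact K"
    by (simp add: euclidean_product_topology)
  have "closed {x. (\<Sum>u\<in>V. (x u)\<^sup>2) = (1::real)}"
    by (intro closed_Collect_eq continuous_intros continuous_on_product_coordinates)
  then have c: "compact (K \<inter> {x. (\<Sum>u\<in>V. (x u)\<^sup>2) = (1::real)})"
    using K by (rule compact_Int_closed[rotated])
  have "\<bar>x u\<bar> \<le> 1" if "(\<Sum>u\<in>V. (x u)\<^sup>2) = (1::real)" "u \<in> V" for x u
  proof -
    have "(x u)\<^sup>2 \<le> (\<Sum>u\<in>V. (x u)\<^sup>2)"
      using assms that by (intro member_le_sum) auto
    then show ?thesis
      using that by (simp add: abs_square_le_1)
  qed
  then have "?S = K \<inter> {x. (\<Sum>u\<in>V. (x u)\<^sup>2) = (1::real)}"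
    unfolding K_def by (auto simp: PiE_def Pi_def abs_le_iff)
  with c show ?thesis by simp
qed

text \<open>The quadratic form is continuous and so attains its maximum on the compact unit sphere;
  homogeneity of degree two carries the bound from the sphere to every vector.\<close>

lemma rayleigh_maximizer:
  fixes a :: "'a \<Rightarrow> 'a \<Rightarrow> real"
  assumes "finite V" "V \<noteq> {}"
  obtains x where "(\<Sum>u\<in>V. (x u)\<^sup>2) = 1"
    "\<And>y. (\<Sum>u\<in>V. \<Sum>v\<in>V. a u v * y u * y v)
      \<le> (\<Sum>u\<in>V. \<Sum>v\<in>V. a u v * x u * x v) * (\<Sum>u\<in>V. (y u)\<^sup>2)"
proof -
  define S where "S = {x. (\<Sum>u\<in>V. (x u)\<^sup>2) = (1::real) \<and> (\<forall>u. u \<notin> V \<longrightarrow> x u = 0)}"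
  define f where "f x = (\<Sum>u\<in>V. \<Sum>v\<in>V. a u v * x u * x v)" for x
  obtain w where w: "w \<in> V" using assms by auto
  have "(\<lambda>u. if u = w then 1 else 0) \<in> S"
    using w assms unfolding S_def by (auto simp: if_distrib[where f="\<lambda>x. x\<^sup>2"] cong: if_cong)
  then have "S \<noteq> {}" by auto
  moreover have "compact S"
    unfolding S_def by (rule compact_unit_sphere_fun) fact
  moreover have "continuous_on S f"
    unfolding f_def
    by (intro continuous_intros continuous_on_subset[OF continuous_on_product_coordinates]) auto
  ultimately obtain x where x: "x \<in> S" "\<And>y. y \<in> S \<Longrightarrow> f y \<le> f x"
    using continuous_attains_sup[of S f] by blast
  have "f y \<le> f x * (\<Sum>u\<in>V. (y u)\<^sup>2)" for y
  proof (cases "(\<Sum>u\<in>V. (y u)\<^sup>2) = 0")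
    case True
    then have "\<forall>u\<in>V. y u = 0"
      using assms by (simp add: sum_nonneg_eq_0_iff)
    then show ?thesis by (simp add: f_def)
  next
    case False
    define c where "c = (\<Sum>u\<in>V. (y u)\<^sup>2)"
    have "c > 0" using False unfolding c_def by (simp add: sum_nonneg order.not_eq_order_implies_strict)
    define z where "z u = (if u \<in> V then y u / sqrt c else 0)" for u
    have "(\<Sum>u\<in>V. (z u)\<^sup>2) = (\<Sum>u\<in>V. (y u)\<^sup>2 / c)"
      using \<open>c > 0\<close> by (intro sum.cong) (auto simp: z_def power_divide)
    also have "\<dots> = 1"
      using \<open>c > 0\<close> by (simp add: c_def flip: sum_divide_distrib)
    finally have "z \<in> S" by (simp add: S_def z_def)
    moreover have "f z = f y / c"
      unfolding f_def sum_divide_distrib using \<open>c > 0\<close>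
      by (intro sum.cong refl) (auto simp: z_def)
    ultimately show ?thesis
      using x(2)[of z] \<open>c > 0\<close> by (simp add: field_simps c_def)
  qed
  then show ?thesis
    using that[of x] x(1) unfolding f_def S_def by blast
qed

text \<open>\<open>M\<close> is the maximum of the Rayleigh quotient. Since \<open>a\<close> is
  nonnegative, taking absolute values in a maximizer does not decrease the form, so
  \<open>\<bar>z\<bar>\<close> is a maximizer too; the first-order condition at a maximizer is the
  eigenvalue equation.\<close>

lemma perron_vector:
  fixes a :: "'a \<Rightarrow> 'a \<Rightarrow> real"
  assumes fin: "finite V" and ne: "V \<noteq> {}"
    and sym: "\<And>u v. u \<in> V \<Longrightarrow> v \<in> V \<Longrightarrow> a u v = a v u"
    and nonneg: "\<And>u v. u \<in> V \<Longrightarrow> v \<in> V \<Longrightarrow> a u v \<ge> 0"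
  obtains M x where "(\<Sum>u\<in>V. (x u)\<^sup>2) = 1" "\<And>u. u \<in> V \<Longrightarrow> x u \<ge> 0"
    "\<And>u. u \<in> V \<Longrightarrow> (\<Sum>v\<in>V. a u v * x v) = M * x u"
    "\<And>y. (\<Sum>u\<in>V. \<Sum>v\<in>V. a u v * y u * y v) \<le> M * (\<Sum>u\<in>V. (y u)\<^sup>2)"
proof -
  define f where "f x = (\<Sum>u\<in>V. \<Sum>v\<in>V. a u v * x u * x v)" for x
  obtain z where z: "(\<Sum>u\<in>V. (z u)\<^sup>2) = 1" "\<And>y. f y \<le> f z * (\<Sum>u\<in>V. (y u)\<^sup>2)"
    using rayleigh_maximizer[OF fin ne, of a] unfolding f_def by blast
  define x where "x u = \<bar>z u\<bar>" for u
  define M where "M = f z"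
  have norm: "(\<Sum>u\<in>V. (x u)\<^sup>2) = 1" using z by (simp add: x_def)
  have "f z \<le> f x"
    unfolding f_def x_def
  proof (intro sum_mono)
    fix u v assume "u \<in> V" "v \<in> V"
    then show "a u v * z u * z v \<le> a u v * \<bar>z u\<bar> * \<bar>z v\<bar>"
      using nonneg[of u v] mult_left_mono[of "z u * z v" "\<bar>z u\<bar> * \<bar>z v\<bar>" "a u v"]
      by (simp add: mult.assoc flip: abs_mult)
  qed
  then have fx: "f x = M" using z(2)[of x] norm by (simp add: M_def)
  have "(\<Sum>v\<in>V. a u v * x v) = M * x u" if u: "u \<in> V" for u
  proof -
    define d where "d = (\<Sum>v\<in>V. a u v * x v) - M * x u"
    \<comment> \<open>The vector \<open>x\<close> is perturbed by \<open>e\<close> in the coordinate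
      \<open>u\<close> only. The bound \<open>f y \<le> M * (\<Sum>u\<in>V. (y u)\<^sup>2)\<close>
      then leaves a term linear in \<open>e\<close> against a quadratic one, for every
      \<open>e\<close>.\<close>
    have *: "2 * e * d \<le> e\<^sup>2 * (M - a u u)" for e
    proof -
      define y where "y = x(u := x u + e)"
      have split: "(\<Sum>v\<in>V. g v) = g u + (\<Sum>v\<in>V-{u}. g v)" for g :: "'a \<Rightarrow> real"
        using fin u by (simp add: sum.remove)
      have ny: "(\<Sum>v\<in>V. (y v)\<^sup>2) = 1 + 2 * e * x u + e\<^sup>2"
      proof -
        have "(\<Sum>v\<in>V-{u}. (y v)\<^sup>2) = (\<Sum>v\<in>V-{u}. (x v)\<^sup>2)"
          by (intro sum.cong) (auto simp: y_def)
        then show ?thesis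
          using norm split[of "\<lambda>v. (y v)\<^sup>2"] split[of "\<lambda>v. (x v)\<^sup>2"]
          by (simp add: y_def power2_eq_square algebra_simps)
      qed
      define b where "b v = (if v = u then e else 0)" for v
      have y: "y v = x v + b v" for v by (simp add: y_def b_def)
      have sum_b: "(\<Sum>v\<in>V. b v * g v) = e * g u" for g
        using fin u by (simp add: b_def if_distrib[where f="\<lambda>x. x * _"] cong: if_cong)
      \<comment> \<open>Bilinear expansion at \<open>y = x + b\<close>: sums against
        \<open>b\<close> collapse to the coordinate \<open>u\<close>, and the symmetry of
        \<open>a\<close> makes the two mixed sums equal.\<close>
      have "f y = (\<Sum>w\<in>V. \<Sum>v\<in>V. a w v * x w * x v) + (\<Sum>w\<in>V. \<Sum>v\<in>V. b v * (a w v * x w))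
          + (\<Sum>w\<in>V. \<Sum>v\<in>V. b w * (a w v * x v)) + (\<Sum>w\<in>V. \<Sum>v\<in>V. b w * (b v * a w v))"
        unfolding f_def y by (simp add: algebra_simps sum.distrib)
      also have "(\<Sum>w\<in>V. \<Sum>v\<in>V. b v * (a w v * x w)) = (\<Sum>w\<in>V. e * (a w u * x w))"
        by (simp only: sum_b)
      also have "\<dots> = e * (\<Sum>v\<in>V. a u v * x v)"
        unfolding sum_distrib_left using sym u by (intro sum.cong) auto
      also have "(\<Sum>w\<in>V. \<Sum>v\<in>V. b w * (a w v * x v)) = e * (\<Sum>v\<in>V. a u v * x v)"
        by (simp only: sum_b flip: sum_distrib_left)
      also have "(\<Sum>w\<in>V. \<Sum>v\<in>V. b w * (b v * a w v)) = e\<^sup>2 * a u u"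
        by (simp only: sum_b power2_eq_square mult.assoc flip: sum_distrib_left)
      finally have "f y = M + 2 * e * (\<Sum>v\<in>V. a u v * x v) + e\<^sup>2 * a u u"
        using fx by (simp add: f_def algebra_simps)
      then show ?thesis
        using z(2)[of y] ny by (simp add: d_def algebra_simps flip: M_def)
    qed
    have "d = 0"
    proof (rule ccontr)
      assume "d \<noteq> 0"
      \<comment> \<open>Any positive \<open>c\<close> above \<open>M - a u u\<close> would do: at
        \<open>e = d / c\<close> the linear side is \<open>2 * d\<^sup>2 / c\<close>, while the
        quadratic side is at most half of that.\<close>
      define c where "c = \<bar>M - a u u\<bar> + 1"
      have c: "c > 0" "M - a u u < c" unfolding c_def by auto
      have "2 * d\<^sup>2 / c \<le> d\<^sup>2 / c\<^sup>2 * (M - a u u)"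
        using *[of "d / c"] by (simp add: power2_eq_square)
      also have "\<dots> \<le> d\<^sup>2 / c\<^sup>2 * c"
        using c by (intro mult_left_mono) auto
      also have "\<dots> = d\<^sup>2 / c" using c by (simp add: power2_eq_square)
      finally have "d\<^sup>2 / c \<le> 0" by simp
      with c \<open>d \<noteq> 0\<close> show False by (simp add: divide_le_0_iff)
    qed
    then show ?thesis by (simp add: d_def)
  qed
  then show ?thesis
    using that[of x M] norm z(2) unfolding x_def f_def M_def by (simp add: x_def)
qed

text \<open>Bridge between matrices, indexed by positions in the enumeration, and the sums over
  vertices used for the quadratic form.\<close>

lemma mult_mat_vec_adjacency_matrix:
  assumes vs: "distinct vs" "set vs = pverts G" and v: "v \<in> carrier_vec (length vs)"
    and z: "\<And>i. i < length vs \<Longrightarrow> z (vs ! i) = v $ i" and i: "i < length vs"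
  shows "(adjacency_matrix G vs *\<^sub>v v) $ i
    = (\<Sum>w\<in>pverts G. (if (vs ! i, w) \<in> parcs G then 1 else 0) * z w)"
proof -
  have "(adjacency_matrix G vs *\<^sub>v v) $ i
      = (\<Sum>j<length vs. (if (vs ! i, vs ! j) \<in> parcs G then 1 else 0) * z (vs ! j))"
    using i v z by (auto simp: adjacency_matrix_def scalar_prod_def lessThan_atLeast0 intro!: sum.cong)
  also have "\<dots> = (\<Sum>w\<in>pverts G. (if (vs ! i, w) \<in> parcs G then 1 else 0) * z w)"
    using bij_betw_nth[OF vs(1) refl refl] vs(2)
    by (intro sum.reindex_bij_betw) (simp add: lessThan_atLeast0)
  finally show ?thesis .
qed

text \<open>The maximal Rayleigh quotient \<open>M\<close> is an eigenvalue and bounds every other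
  one, so it is the spectral radius. Strict positivity comes from connectedness: a zero entry of a
  nonnegative eigenvector spreads along arcs to all vertices, contradicting norm 1.\<close>

lemma graph_spectral_radius_perron:
  fixes G :: "'a pair_pre_digraph"
  assumes "pair_graph G" and conn: "Digraph_Component.connected (with_proj G)"
  defines "a \<equiv> \<lambda>u v. if (u, v) \<in> parcs G then 1 else (0::real)"
  obtains x where "(\<Sum>u\<in>pverts G. (x u)\<^sup>2) = 1" "\<forall>u\<in>pverts G. x u > 0"
    "\<forall>u\<in>pverts G. (\<Sum>v\<in>pverts G. a u v * x v) = graph_spectral_radius G * x u"
    "\<forall>y. (\<Sum>u\<in>pverts G. \<Sum>v\<in>pverts G. a u v * y u * y v)
      \<le> graph_spectral_radius G * (\<Sum>u\<in>pverts G. (y u)\<^sup>2)"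
proof -
  interpret pair_graph G by fact
  let ?V = "pverts G"
  have sc: "strongly_connected (with_proj G)"
    using conn pair_sym_arcs by (rule symmetric_connected_imp_strongly_connected[rotated])
  then have ne: "?V \<noteq> {}" by (auto simp: strongly_connected_def)
  have symG: "(u, v) \<in> parcs G \<longleftrightarrow> (v, u) \<in> parcs G" for u v
    using pair_sym_arcs by (auto simp: symmetric_def sym_def)
  obtain M x where x: "(\<Sum>u\<in>?V. (x u)\<^sup>2) = 1" "\<And>u. u \<in> ?V \<Longrightarrow> x u \<ge> 0"
    "\<And>u. u \<in> ?V \<Longrightarrow> (\<Sum>v\<in>?V. a u v * x v) = M * x u"
    "\<And>y. (\<Sum>u\<in>?V. \<Sum>v\<in>?V. a u v * y u * y v) \<le> M * (\<Sum>u\<in>?V. (y u)\<^sup>2)"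
    by (rule perron_vector[OF pair_finite_verts ne, of a]) (auto simp: a_def symG)
  \<comment> \<open>The eigenvalue equation at \<open>u\<close> is a vanishing sum of nonnegative
    terms, so each neighbour of \<open>u\<close> carries weight 0.\<close>
  have zero_step: "x v = 0" if "u \<in> ?V" "x u = 0" "(u, v) \<in> parcs G" for u v
  proof -
    have v: "v \<in> ?V" using that in_arcsD2 by blast
    have "(\<Sum>v\<in>?V. a u v * x v) = 0" using x(3)[OF that(1)] that(2) by simp
    then have "\<forall>v\<in>?V. a u v * x v = 0"
      using x(2) pair_finite_verts by (subst (asm) sum_nonneg_eq_0_iff) (auto simp: a_def)
    with v that(3) show ?thesis by (auto simp: a_def)
  qed
  have pos: "x u > 0" if u: "u \<in> ?V" for u
  proof (rule ccontr)
    assume "\<not> x u > 0"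
    with x(2)[OF u] have u0: "x u = 0" by simp
    have "x v = 0" if v: "v \<in> ?V" for v
    proof -
      have "u \<rightarrow>\<^sup>*\<^bsub>with_proj G\<^esub> v" using sc u v by (auto simp: strongly_connected_def)
      then have "v \<in> ?V \<and> x v = 0"
      proof (induction rule: reachable_induct)
        case base then show ?case using u u0 by simp
      next
        case (step w v)
        then show ?case using zero_step[of w v] in_arcsD2[of w v] by auto
      qed
      then show ?thesis ..
    qed
    then show False using x(1) by simp
  qed
  define vs where "vs = (SOME vs. distinct vs \<and> set vs = ?V)"
  have "\<exists>vs. distinct vs \<and> set vs = ?V"
    using finite_distinct_list[OF pair_finite_verts] by blast
  then have vs: "distinct vs" "set vs = ?V"
    using someI_ex[of "\<lambda>vs. distinct vs \<and> set vs = ?V"] unfolding vs_def by auto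
  let ?A = "adjacency_matrix G vs" and ?n = "length vs"
  have A: "?A \<in> carrier_mat ?n ?n" by (simp add: adjacency_matrix_def)
  have "M \<in> spectrum ?A"
  proof -
    define v where "v = vec ?n (\<lambda>i. x (vs ! i))"
    obtain u where "u \<in> ?V" using ne by auto
    then obtain i where "i < ?n" "vs ! i = u" using vs by (metis in_set_conv_nth)
    then have "v $ i \<noteq> 0" using pos \<open>u \<in> ?V\<close> by (force simp: v_def)
    then have "v \<noteq> 0\<^sub>v ?n" using \<open>i < ?n\<close> by auto
    moreover have "?A *\<^sub>v v = M \<cdot>\<^sub>v v"
    proof (rule eq_vecI)
      fix i assume "i < dim_vec (M \<cdot>\<^sub>v v)"
      then have i: "i < ?n" by (simp add: v_def)
      then have "vs ! i \<in> ?V" using vs nth_mem by blast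
      then show "(?A *\<^sub>v v) $ i = (M \<cdot>\<^sub>v v) $ i"
        using mult_mat_vec_adjacency_matrix[OF vs, of v x i] x(3) i by (simp add: v_def a_def)
    qed (simp add: adjacency_matrix_def v_def)
    ultimately show ?thesis
      using A unfolding spectrum_def eigenvalue_def eigenvector_def
      by (auto intro!: exI[of _ v] simp: v_def)
  qed
  moreover have "l \<le> M" if "l \<in> spectrum ?A" for l
  proof -
    obtain v where v: "v \<in> carrier_vec ?n" "v \<noteq> 0\<^sub>v ?n" "?A *\<^sub>v v = l \<cdot>\<^sub>v v"
    proof -
      obtain v where "eigenvector ?A v l"
        using \<open>l \<in> spectrum ?A\<close> by (auto simp: spectrum_def eigenvalue_def)
      then show ?thesis using A by (intro that[of v]) (simp_all add: eigenvector_def)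
    qed
    \<comment> \<open>The eigenvector is read as a function on vertices; as \<open>vs\<close> is
      distinct, each vertex has a unique position.\<close>
    define z where "z u = v $ (THE i. i < ?n \<and> vs ! i = u)" for u
    have z: "z (vs ! i) = v $ i" if "i < ?n" for i
    proof -
      have "(THE j. j < ?n \<and> vs ! j = vs ! i) = i"
        using that vs(1) by (intro the_equality) (auto simp: nth_eq_iff_index_eq)
      then show ?thesis by (simp add: z_def)
    qed
    have ev: "(\<Sum>w\<in>?V. a u w * z w) = l * z u" if "u \<in> ?V" for u
    proof -
      obtain i where i: "i < ?n" "vs ! i = u"
        using \<open>u \<in> ?V\<close> vs by (metis in_set_conv_nth)
      have "(?A *\<^sub>v v) $ i = l * z u"
        unfolding v(3) using v(1) i z[of i] by simp
      then show ?thesis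
        using mult_mat_vec_adjacency_matrix[OF vs v(1) z i(1)] i(2) by (simp add: a_def)
    qed
    obtain i where i: "i < ?n" "v $ i \<noteq> 0"
      using v(1,2) by (metis carrier_vecD eq_vecI index_zero_vec)
    then have "vs ! i \<in> ?V" "z (vs ! i) \<noteq> 0" using vs z by auto
    then have pos: "(\<Sum>u\<in>?V. (z u)\<^sup>2) > 0"
      using pair_finite_verts by (intro sum_pos2[of _ "vs ! i"]) auto
    have "(\<Sum>u\<in>?V. \<Sum>w\<in>?V. a u w * z u * z w) = (\<Sum>u\<in>?V. z u * (\<Sum>w\<in>?V. a u w * z w))"
      by (simp add: sum_distrib_left mult_ac)
    also have "\<dots> = (\<Sum>u\<in>?V. l * (z u)\<^sup>2)"
      using ev by (intro sum.cong) (simp_all add: power2_eq_square mult_ac)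
    finally have "l * (\<Sum>u\<in>?V. (z u)\<^sup>2) \<le> M * (\<Sum>u\<in>?V. (z u)\<^sup>2)"
      using x(4)[of z] by (simp flip: sum_distrib_left)
    with pos show ?thesis by simp
  qed
  ultimately have "graph_spectral_radius G = M"
    unfolding graph_spectral_radius_def vs_def[symmetric]
    using card_finite_spectrum(1)[OF A] by (intro Max_eqI) auto
  then show ?thesis using that[of x] x pos by blast
qed

section \<open>Linear families and clique partitions\<close>

text \<open>For the incidence matrix \<open>N\<close> of \<open>R\<close> this is
  \<open>|N^T x|^2 = x^T (N N^T) x\<close>. The relation is left arbitrary so that the identity
  serves both for vertices against cliques and with the two sides exchanged.\<close>

lemma sum_square_incidence:
  fixes x :: "'a \<Rightarrow> real"
  assumes "finite V" "finite F"
  shows "(\<Sum>q\<in>F. (\<Sum>v\<in>V. of_bool (R v q) * x v)\<^sup>2)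
    = (\<Sum>u\<in>V. \<Sum>v\<in>V. real (card {q \<in> F. R u q \<and> R v q}) * x u * x v)"
proof -
  have "(\<Sum>q\<in>F. (\<Sum>v\<in>V. of_bool (R v q) * x v)\<^sup>2)
      = (\<Sum>q\<in>F. \<Sum>u\<in>V. \<Sum>v\<in>V. of_bool (R u q \<and> R v q) * x u * x v)"
    by (simp add: power2_eq_square sum_product of_bool_conj mult_ac)
  also have "\<dots> = (\<Sum>u\<in>V. \<Sum>v\<in>V. \<Sum>q\<in>F. of_bool (R u q \<and> R v q) * x u * x v)"
    by (subst sum.swap) (intro sum.cong refl sum.swap)
  also have "\<dots> = (\<Sum>u\<in>V. \<Sum>v\<in>V. real (card {q \<in> F. R u q \<and> R v q}) * x u * x v)"
  proof (intro sum.cong refl)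
    fix u v
    have "(\<Sum>q\<in>F. of_bool (R u q \<and> R v q)) = real (card {q \<in> F. R u q \<and> R v q})"
      using assms by (simp add: sum_of_bool_eq Int_def)
    then show "(\<Sum>q\<in>F. of_bool (R u q \<and> R v q) * x u * x v)
        = real (card {q \<in> F. R u q \<and> R v q}) * x u * x v"
      by (simp only: flip: sum_distrib_right)
  qed
  finally show ?thesis .
qed

text \<open>Let \<open>N\<close> be the incidence matrix of points and members of \<open>F\<close>,
  \<open>y = N^T x\<close> and \<open>w = N y\<close>. Then \<open>x . w = |y|^2 = Y\<close> and
  \<open>Z = |w|^2 = y^T (N^T N) y\<close>. The entries of \<open>N^T N\<close> are at most those of
  \<open>(t - 1) I + J\<close> (\<open>J\<close> all ones), whose largest eigenvalue is
  \<open>c\<close> when \<open>F\<close> is nonempty. As \<open>y\<close> is nonnegative,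
  \<open>Z \<le> c * Y\<close>. In the equality case every entry bound is attained.\<close>

lemma
  fixes x :: "'a \<Rightarrow> real" and t :: nat
  assumes fin: "finite V" and F: "\<And>Q. Q \<in> F \<Longrightarrow> Q \<subseteq> V"
    and t: "t \<ge> 2" and size: "\<And>Q. Q \<in> F \<Longrightarrow> card Q \<le> t"
    and inter: "\<And>Q Q'. Q \<in> F \<Longrightarrow> Q' \<in> F \<Longrightarrow> Q \<noteq> Q' \<Longrightarrow> card (Q \<inter> Q') \<le> 1"
    and norm: "(\<Sum>v\<in>V. (x v)\<^sup>2) = 1" and pos: "\<And>v. v \<in> V \<Longrightarrow> x v > 0"
  shows linear_family_sum_squares_le: "(\<Sum>Q\<in>F. (sum x Q)\<^sup>2) \<le> real t + real (card F) - 1"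
    and linear_family_sum_squares_eqD:
      "(\<Sum>Q\<in>F. (sum x Q)\<^sup>2) = real t + real (card F) - 1 \<Longrightarrow> {} \<notin> F \<Longrightarrow>
        (\<forall>Q\<in>F. card Q = t) \<and> (\<forall>Q\<in>F. \<forall>Q'\<in>F. Q \<noteq> Q' \<longrightarrow> card (Q \<inter> Q') = 1)"
proof -
  define c where "c = real t + real (card F) - 1"
  have c: "c > 0" using t by (simp add: c_def)
  have finF: "finite F" using F fin by (meson finite_Pow_iff finite_subset PowI subsetI)
  have finQ: "finite Q" if "Q \<in> F" for Q using F fin that finite_subset by blast
  define y where "y = sum x"
  define Y where "Y = (\<Sum>Q\<in>F. (y Q)\<^sup>2)"
  define w where "w v = (\<Sum>Q\<in>F. of_bool (v \<in> Q) * y Q)" for v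
  define Z where "Z = (\<Sum>v\<in>V. (w v)\<^sup>2)"
  have y: "y Q = (\<Sum>v\<in>V. of_bool (v \<in> Q) * x v)" if "Q \<in> F" for Q
    using F[OF that] fin by (simp add: y_def Int_absorb1 flip: sum.inter_restrict)
  have "(\<Sum>v\<in>V. x v * w v) = (\<Sum>v\<in>V. \<Sum>Q\<in>F. y Q * (of_bool (v \<in> Q) * x v))"
    by (simp add: w_def sum_distrib_left mult_ac)
  also have "\<dots> = (\<Sum>Q\<in>F. y Q * (\<Sum>v\<in>V. of_bool (v \<in> Q) * x v))"
    by (subst sum.swap) (simp add: sum_distrib_left)
  also have "\<dots> = Y" unfolding Y_def by (intro sum.cong) (simp_all add: power2_eq_square y)
  finally have xw: "(\<Sum>v\<in>V. x v * w v) = Y" .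
  \<comment> \<open>Replaces the Cauchy--Schwarz inequality for \<open>x\<close> and \<open>w\<close>: combined with \<open>Z \<le> c Y\<close> below it gives \<open>Y \<le> c\<close>.\<close>
  have "0 \<le> (\<Sum>v\<in>V. (w v - c * x v)\<^sup>2)" by (simp add: sum_nonneg)
  also have "\<dots> = Z - 2 * c * (\<Sum>v\<in>V. x v * w v) + c\<^sup>2 * (\<Sum>v\<in>V. (x v)\<^sup>2)"
    by (simp add: Z_def power2_diff power_mult_distrib sum.distrib sum_subtractf sum_distrib_left mult_ac)
  finally have cs: "2 * c * Y \<le> Z + c\<^sup>2" by (simp add: xw norm)
  define g where "g Q Q' = real (card (Q \<inter> Q')) * y Q * y Q'" for Q Q'
  \<comment> \<open>A termwise majorant of \<open>g\<close>: the product of two weights is bounded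
    by the mean of their squares, and the extra diagonal term raises the coefficient from 1 to
    \<open>t\<close>. Its double sum is exactly \<open>c * Y\<close>.\<close>
  define h where
    "h Q Q' = ((y Q)\<^sup>2 + (y Q')\<^sup>2) / 2 + (if Q = Q' then (real t - 1) * (y Q)\<^sup>2 else 0)" for Q Q'
  have Z: "Z = (\<Sum>Q\<in>F. \<Sum>Q'\<in>F. g Q Q')"
  proof -
    have "{q \<in> V. q \<in> Q \<and> q \<in> Q'} = Q \<inter> Q'" if "Q \<in> F" for Q Q'
      using F[OF that] by auto
    then show ?thesis
      unfolding Z_def w_def g_def sum_square_incidence[OF finF fin, of "\<lambda>Q v. v \<in> Q" y]
      by simp
  qed
  have "(\<Sum>Q'\<in>F. h Q Q') = real (card F) / 2 * (y Q)\<^sup>2 + Y / 2 + (real t - 1) * (y Q)\<^sup>2"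
    if "Q \<in> F" for Q
    using finF that by (simp add: h_def sum.distrib Y_def add_divide_distrib flip: sum_divide_distrib)
  then have "(\<Sum>Q\<in>F. \<Sum>Q'\<in>F. h Q Q')
      = (\<Sum>Q\<in>F. real (card F) / 2 * (y Q)\<^sup>2 + Y / 2 + (real t - 1) * (y Q)\<^sup>2)"
    by simp
  also have "\<dots> = real (card F) / 2 * Y + real (card F) * (Y / 2) + (real t - 1) * Y"
    by (simp only: sum.distrib sum_constant Y_def[symmetric] flip: sum_distrib_left)
  finally have cY: "c * Y = (\<Sum>Q\<in>F. \<Sum>Q'\<in>F. h Q Q')"
    by (simp add: c_def algebra_simps)
  have y0: "y Q \<ge> 0" if "Q \<in> F" for Q
    unfolding y_def using F[OF that] pos by (intro sum_nonneg) (auto intro: less_imp_le)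
  have gh: "g Q Q' \<le> h Q Q'" if "Q \<in> F" "Q' \<in> F" for Q Q'
  proof (cases "Q = Q'")
    case True
    have "real (card Q) * (y Q)\<^sup>2 \<le> real t * (y Q)\<^sup>2"
      using size[OF that(1)] by (intro mult_right_mono) auto
    then show ?thesis using True by (simp add: g_def h_def power2_eq_square algebra_simps)
  next
    case False
    have "real (card (Q \<inter> Q')) * (y Q * y Q') \<le> 1 * (y Q * y Q')"
      using inter[OF that False] y0 that by (intro mult_right_mono) auto
    also have "\<dots> \<le> ((y Q)\<^sup>2 + (y Q')\<^sup>2) / 2"
      using sum_squares_bound[of "y Q" "y Q'"] by simp
    finally show ?thesis using False by (simp add: g_def h_def)
  qed
  then have ZY: "Z \<le> c * Y"
    unfolding Z cY by (intro sum_mono) auto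
  have "c * Y \<le> c * c" using cs ZY by (simp add: power2_eq_square)
  then have Yc: "Y \<le> c" using c by simp
  then show "(\<Sum>Q\<in>F. (sum x Q)\<^sup>2) \<le> real t + real (card F) - 1"
    by (simp add: Y_def c_def y_def)
  assume "(\<Sum>Q\<in>F. (sum x Q)\<^sup>2) = real t + real (card F) - 1" and ne: "{} \<notin> F"
  then have "Y = c" by (simp add: Y_def c_def y_def)
  \<comment> \<open>At \<open>Y = c\<close> the bounds \<open>2 * c * Y \<le> Z + c\<^sup>2\<close>
    and \<open>Z \<le> c * Y\<close> pin \<open>Z\<close> down, so \<open>g\<close> and its majorant
    \<open>h\<close> have equal sums and agree term by term.\<close>
  then have "Z = c * Y" using cs ZY by (simp add: power2_eq_square)
  then have "(\<Sum>Q\<in>F. \<Sum>Q'\<in>F. g Q Q') = (\<Sum>Q\<in>F. \<Sum>Q'\<in>F. h Q Q')" by (simp only: Z cY)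
  then have "(\<Sum>Q'\<in>F. g Q Q') = (\<Sum>Q'\<in>F. h Q Q')" if "Q \<in> F" for Q
    by (rule sum_mono_inv) (auto intro: sum_mono gh finF that)
  then have eq: "g Q Q' = h Q Q'" if "Q \<in> F" "Q' \<in> F" for Q Q'
    by (rule sum_mono_inv) (auto intro: gh finF that)
  \<comment> \<open>Excluding the empty set makes all weights positive, so that they can be
    cancelled from \<open>g = h\<close>.\<close>
  have ypos: "y Q > 0" if "Q \<in> F" for Q
    unfolding y_def using F[OF that] pos finQ[OF that] ne that by (intro sum_pos) auto
  show "(\<forall>Q\<in>F. card Q = t) \<and> (\<forall>Q\<in>F. \<forall>Q'\<in>F. Q \<noteq> Q' \<longrightarrow> card (Q \<inter> Q') = 1)"
  proof (intro conjI ballI impI)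
    fix Q assume Q: "Q \<in> F"
    have "real (card Q) * (y Q)\<^sup>2 = real t * (y Q)\<^sup>2"
      using eq[OF Q Q] by (simp add: g_def h_def power2_eq_square algebra_simps)
    then show "card Q = t" using ypos[OF Q] by simp
  next
    fix Q Q' assume Q: "Q \<in> F" "Q' \<in> F" "Q \<noteq> Q'"
    \<comment> \<open>A positive \<open>h\<close> forces a nonzero \<open>g\<close>, which rules out
      disjoint members.\<close>
    have "((y Q)\<^sup>2 + (y Q')\<^sup>2) / 2 > 0" using ypos[OF Q(1)] by (simp add: add_pos_nonneg)
    then have "card (Q \<inter> Q') \<noteq> 0"
      using eq[OF Q(1,2)] Q(3) by (auto simp: g_def h_def simp del: card_0_eq card_eq_0_iff)
    with inter[OF Q] show "card (Q \<inter> Q') = 1" by simp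
  qed
qed

text \<open>An isomorphism record has a separate arc map, but arcs here are pairs with the
  projections as ends, so that map is induced by the vertex map. This leaves the usual notion of
  isomorphism of simple graphs.\<close>

lemma digraph_iso_with_proj_iff:
  assumes "pair_wf_digraph G" "pair_wf_digraph H"
  shows "digraph_iso (with_proj G) (with_proj H) \<longleftrightarrow>
    (\<exists>f. bij_betw f (pverts G) (pverts H) \<and>
      (\<forall>u\<in>pverts G. \<forall>v\<in>pverts G. (u, v) \<in> parcs G \<longleftrightarrow> (f u, f v) \<in> parcs H))"
    (is "?L \<longleftrightarrow> ?R")
proof -
  interpret G: pair_wf_digraph G by fact
  interpret H: pair_wf_digraph H by fact
  show ?thesis
  proof
    assume ?L
    then obtain h where h: "pre_digraph.digraph_isomorphism (with_proj G) h"
      and eq: "with_proj H = app_iso h (with_proj G)"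
      by (auto simp: digraph_iso_def)
    let ?f = "iso_verts h"
    \<comment> \<open>Comparing components forces the tail and head maps of \<open>h\<close> to be
      the projections, whence \<open>iso_arcs h\<close> applies \<open>?f\<close> to both
      ends.\<close>
    have V: "pverts H = ?f ` pverts G" and E: "parcs H = iso_arcs h ` parcs G"
      and "iso_tail h = fst" "iso_head h = snd"
      using arg_cong[OF eq, of verts] arg_cong[OF eq, of arcs]
        arg_cong[OF eq, of tail] arg_cong[OF eq, of head] by simp_all
    then have arcs: "iso_arcs h e = (?f (fst e), ?f (snd e))" if "e \<in> parcs G" for e
      using h that by (auto simp: pre_digraph.digraph_isomorphism_def prod_eq_iff)
    have inj: "inj_on ?f (pverts G)"
      using h by (auto simp: pre_digraph.digraph_isomorphism_def)
    have "(u, v) \<in> parcs G" if "u \<in> pverts G" "v \<in> pverts G" "(?f u, ?f v) \<in> parcs H" for u v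
    proof -
      from that(3) obtain e where e: "e \<in> parcs G" "iso_arcs h e = (?f u, ?f v)"
        unfolding E by force
      then have "fst e = u" "snd e = v"
        using arcs[of e] inj that(1,2) G.arc_fst_in_verts G.arc_snd_in_verts
        by (auto dest: inj_onD)
      with e(1) show ?thesis by auto
    qed
    moreover have "(?f u, ?f v) \<in> parcs H" if "(u, v) \<in> parcs G" for u v
      using arcs[OF that] that unfolding E by force
    ultimately show ?R
      using inj V by (intro exI[of _ ?f]) (auto simp: bij_betw_def)
  next
    assume ?R
    then obtain f where f: "inj_on f (pverts G)" "f ` pverts G = pverts H"
      and arcs: "\<And>u v. u \<in> pverts G \<Longrightarrow> v \<in> pverts G \<Longrightarrow> (u, v) \<in> parcs G \<longleftrightarrow> (f u, f v) \<in> parcs H"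
      by (auto simp: bij_betw_def)
    define h where "h = \<lparr>iso_verts = f, iso_arcs = map_prod f f, iso_head = snd, iso_tail = fst\<rparr>"
    have sub: "parcs G \<subseteq> pverts G \<times> pverts G"
      using G.in_arcsD1 G.in_arcsD2 by auto
    have "inj_on (map_prod f f) (parcs G)"
      using map_prod_inj_on[OF f(1) f(1)] sub by (rule inj_on_subset)
    then have "pre_digraph.digraph_isomorphism (with_proj G) h"
      using f(1) G.wf_digraph_axioms by (auto simp: pre_digraph.digraph_isomorphism_def h_def)
    moreover have "map_prod f f ` parcs G = parcs H"
    proof (intro equalityI subsetI)
      fix e assume "e \<in> map_prod f f ` parcs G"
      then show "e \<in> parcs H" using arcs sub by auto
    next
      fix e assume e: "e \<in> parcs H"
      then have "fst e \<in> f ` pverts G" "snd e \<in> f ` pverts G"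
        using f(2) H.arc_fst_in_verts H.arc_snd_in_verts by auto
      then obtain u v where "u \<in> pverts G" "v \<in> pverts G" "e = (f u, f v)"
        by (auto simp: prod_eq_iff)
      then show "e \<in> map_prod f f ` parcs G" using arcs e by force
    qed
    then have "with_proj H = app_iso h (with_proj G)"
      using f(2) by (simp add: app_iso_def with_proj_def h_def)
    ultimately show ?L by (auto simp: digraph_iso_def)
  qed
qed

lemma pair_wf_digraph_block_graph: "pair_wf_digraph (block_graph I B)"
  by unfold_locales (auto simp: block_graph_def)

section \<open>Degrees and their relation to the spectral radius\<close>

context pair_graph
begin

lemma out_degree_eq_card: "out_degree (with_proj G) v = card {w. (v, w) \<in> parcs G}"
proof -
  have "out_arcs (with_proj G) v = Pair v ` {w. (v, w) \<in> parcs G}"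
    by (auto simp: out_arcs_def)
  then show ?thesis by (simp add: out_degree_def card_image inj_on_def)
qed

lemma min_degree_le: "v \<in> pverts G \<Longrightarrow> min_degree G \<le> card {w. (v, w) \<in> parcs G}"
  using pair_finite_verts unfolding min_degree_def by (auto simp flip: out_degree_eq_card)

end

text \<open>The Rayleigh bound is tested on the all-ones vector, whose form value is the sum of the
  degrees.\<close>

lemma min_degree_le_spectral_radius:
  assumes "pair_graph G" and "Digraph_Component.connected (with_proj G)"
  shows "real (min_degree G) \<le> graph_spectral_radius G"
proof -
  interpret pair_graph G by fact
  let ?V = "pverts G"
  have ne: "?V \<noteq> {}"
    using assms(2) by (auto simp: connected_def strongly_connected_def)
  have deg: "(\<Sum>v\<in>?V. if (u, v) \<in> parcs G then 1 else 0) = real (card {w. (u, w) \<in> parcs G})" for u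
  proof -
    have "?V \<inter> {v. (u, v) \<in> parcs G} = {w. (u, w) \<in> parcs G}" using in_arcsD2 by auto
    then show ?thesis
      using pair_finite_verts by (simp add: sum.If_cases)
  qed
  have rayleigh: "(\<Sum>u\<in>?V. \<Sum>v\<in>?V. (if (u, v) \<in> parcs G then 1 else 0) * y u * y v)
      \<le> graph_spectral_radius G * (\<Sum>u\<in>?V. (y u)\<^sup>2)" for y
    by (rule graph_spectral_radius_perron[OF assms]) blast
  have "real (min_degree G) * card ?V = (\<Sum>u\<in>?V. real (min_degree G))" by simp
  also have "\<dots> \<le> (\<Sum>u\<in>?V. real (card {w. (u, w) \<in> parcs G}))"
    by (intro sum_mono) (simp add: min_degree_le)
  also have "\<dots> = (\<Sum>u\<in>?V. \<Sum>v\<in>?V. (if (u, v) \<in> parcs G then 1 else 0) * 1 * 1)"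
    by (simp add: deg)
  also have "\<dots> \<le> graph_spectral_radius G * (\<Sum>u\<in>?V. 1\<^sup>2)"
    by (rule rayleigh)
  finally show ?thesis
    using ne pair_finite_verts by (simp add: card_gt_0_iff)
qed

lemma clique_partitionI:
  assumes "\<And>Q. Q \<in> \<Q> \<Longrightarrow> clique G Q"
    and "\<And>u v. (u, v) \<in> parcs G \<Longrightarrow> \<exists>!Q. Q \<in> \<Q> \<and> u \<in> Q \<and> v \<in> Q"
  shows "clique_partition G \<Q>"
proof -
  have "case e of (u, v) \<Rightarrow> \<exists>!Q. Q \<in> \<Q> \<and> u \<in> Q \<and> v \<in> Q" if "e \<in> parcs G" for e
    using assms(2) that by (cases e) simp
  then show ?thesis using assms(1) unfolding clique_partition_def by blast
qed

section \<open>Partitions into cliques of at most t vertices\<close>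

locale bounded_clique_partition = pair_graph G for G :: "'a pair_pre_digraph" +
  fixes t :: nat and \<Q> :: "'a set set"
  assumes t: "t \<ge> 2"
    and partition: "clique_partition G \<Q>"
    and size: "Q \<in> \<Q> \<Longrightarrow> card Q \<le> t"
begin

text \<open>The row of \<open>v\<close> in the vertex-clique incidence matrix. In the dual
  structure, whose points are the cliques, it is the block belonging to \<open>v\<close>.\<close>

definition cliques_at :: "'a \<Rightarrow> 'a set set" where
  "cliques_at v = {Q \<in> \<Q>. v \<in> Q}"

lemma clique_subset: "Q \<in> \<Q> \<Longrightarrow> Q \<subseteq> pverts G"
  using partition by (auto simp: clique_partition_def clique_def)

lemma finite_clique: "Q \<in> \<Q> \<Longrightarrow> finite Q"
  using clique_subset pair_finite_verts finite_subset by blast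

lemma finite_partition: "finite \<Q>"
  using clique_subset pair_finite_verts by (meson finite_Pow_iff finite_subset PowI subsetI)

lemma adjacent: "Q \<in> \<Q> \<Longrightarrow> u \<in> Q \<Longrightarrow> v \<in> Q \<Longrightarrow> u \<noteq> v \<Longrightarrow> (u, v) \<in> parcs G"
  using partition by (auto simp: clique_partition_def clique_def)

lemma adjacentE:
  assumes "(u, v) \<in> parcs G"
  obtains Q where "Q \<in> \<Q>" "u \<in> Q" "v \<in> Q" "u \<noteq> v"
  using assms partition pair_no_loops[of "(u, v)"] unfolding clique_partition_def by force

lemma clique_unique:
  assumes "Q \<in> \<Q>" "Q' \<in> \<Q>" "u \<in> Q" "v \<in> Q" "u \<in> Q'" "v \<in> Q'" "u \<noteq> v"
  shows "Q = Q'"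
  using assms adjacent[OF assms(1,3,4,7)] partition unfolding clique_partition_def by blast

lemma card_inter: "Q \<in> \<Q> \<Longrightarrow> Q' \<in> \<Q> \<Longrightarrow> Q \<noteq> Q' \<Longrightarrow> card (Q \<inter> Q') \<le> 1"
  using clique_unique finite_clique by (auto simp: card_le_Suc0_iff_eq)

text \<open>Off the diagonal, \<open>N N^T\<close> is the adjacency matrix: the clique covering an
  edge is unique, and vertices sharing a clique are adjacent.\<close>

lemma card_common:
  assumes "u \<noteq> v"
  shows "card (cliques_at u \<inter> cliques_at v) = of_bool ((u, v) \<in> parcs G)"
proof (cases "(u, v) \<in> parcs G")
  case True
  then obtain Q where "Q \<in> \<Q>" "u \<in> Q" "v \<in> Q" by (rule adjacentE)
  then have "cliques_at u \<inter> cliques_at v = {Q}"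
    using clique_unique assms unfolding cliques_at_def by blast
  with True show ?thesis by simp
next
  case False
  then have "cliques_at u \<inter> cliques_at v = {}"
    using adjacent assms unfolding cliques_at_def by blast
  with False show ?thesis by simp
qed

text \<open>The cliques through \<open>v\<close>, with \<open>v\<close> removed, partition its
  neighbourhood.\<close>

lemma degree_eq: "card {w. (v, w) \<in> parcs G} = (\<Sum>Q\<in>cliques_at v. card Q - 1)"
proof -
  have "{w. (v, w) \<in> parcs G} = (\<Union>Q\<in>cliques_at v. Q - {v})"
    by (auto simp: cliques_at_def intro: adjacent elim!: adjacentE)
  also have "card \<dots> = (\<Sum>Q\<in>cliques_at v. card (Q - {v}))"
    using finite_partition finite_clique clique_unique[of _ _ v]
    by (intro card_UN_disjoint) (auto simp: cliques_at_def)
  finally show ?thesis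
    by (simp add: cliques_at_def)
qed

lemma degree_le: "card {w. (v, w) \<in> parcs G} \<le> card (cliques_at v) * (t - 1)"
  using sum_bounded_above[of "cliques_at v" "\<lambda>Q. card Q - 1" "t - 1"] size
  by (simp add: degree_eq cliques_at_def diff_le_mono)

text \<open>Each clique at \<open>v\<close> accounts for at most \<open>t - 1\<close> neighbours,
  and the number of cliques is an integer, so the quotient may be rounded up.\<close>

lemma min_degree_ceiling_le:
  assumes "v \<in> pverts G"
  shows "\<lceil>real (min_degree G) / (real t - 1)\<rceil> \<le> int (card (cliques_at v))"
proof -
  have "min_degree G \<le> card (cliques_at v) * (t - 1)"
    using min_degree_le[OF assms] degree_le by (rule order_trans)
  then have "real (min_degree G) \<le> real (card (cliques_at v)) * real (t - 1)"
    by (simp flip: of_nat_mult)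
  then show ?thesis
    using t by (simp add: ceiling_le_iff divide_le_eq of_nat_diff)
qed

text \<open>The identity \<open>N N^T = A + D\<close> as quadratic forms, with \<open>A\<close> the
  adjacency matrix and \<open>D\<close> the diagonal matrix of the numbers of cliques at the
  vertices.\<close>

lemma sum_clique_squares:
  fixes x :: "'a \<Rightarrow> real"
  shows "(\<Sum>Q\<in>\<Q>. (sum x Q)\<^sup>2)
    = (\<Sum>u\<in>pverts G. \<Sum>v\<in>pverts G. (if (u, v) \<in> parcs G then 1 else 0) * x u * x v)
      + (\<Sum>u\<in>pverts G. real (card (cliques_at u)) * (x u)\<^sup>2)"
proof -
  have "(\<Sum>Q\<in>\<Q>. (sum x Q)\<^sup>2) = (\<Sum>Q\<in>\<Q>. (\<Sum>v\<in>pverts G. of_bool (v \<in> Q) * x v)\<^sup>2)"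
    using clique_subset pair_finite_verts
    by (intro sum.cong) (simp_all add: Int_absorb1 flip: sum.inter_restrict)
  also have "\<dots> = (\<Sum>u\<in>pverts G. \<Sum>v\<in>pverts G. real (card (cliques_at u \<inter> cliques_at v)) * x u * x v)"
    unfolding sum_square_incidence[OF pair_finite_verts finite_partition]
    by (intro sum.cong refl arg_cong2[where f="(*)"] arg_cong[where f="\<lambda>S. real (card S)"])
      (auto simp: cliques_at_def)
  also have "\<dots> = (\<Sum>u\<in>pverts G. \<Sum>v\<in>pverts G. (if (u, v) \<in> parcs G then 1 else 0) * x u * x v
      + (if u = v then real (card (cliques_at u)) * (x u)\<^sup>2 else 0))"
    using pair_no_loops
    by (intro sum.cong refl) (force simp: card_common power2_eq_square)
  finally show ?thesis
    using pair_finite_verts by (simp add: sum.distrib)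
qed

lemma double_counting: "(\<Sum>Q\<in>\<Q>. card Q) = (\<Sum>v\<in>pverts G. card (cliques_at v))"
proof -
  have "card Q = (\<Sum>v\<in>pverts G. of_bool (v \<in> Q))" if "Q \<in> \<Q>" for Q
    using clique_subset[OF that] pair_finite_verts
    by (simp add: sum_of_bool_eq Int_absorb1)
  then have "(\<Sum>Q\<in>\<Q>. card Q) = (\<Sum>Q\<in>\<Q>. \<Sum>v\<in>pverts G. of_bool (v \<in> Q))" by simp
  also have "\<dots> = (\<Sum>v\<in>pverts G. \<Sum>Q\<in>\<Q>. of_bool (v \<in> Q))" by (rule sum.swap)
  also have "\<dots> = (\<Sum>v\<in>pverts G. card (cliques_at v))"
    using finite_partition by (simp add: sum_of_bool_eq cliques_at_def Int_def)
  finally show ?thesis .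
qed

text \<open>At the Perron vector the sum of the squared clique weights is the spectral radius plus a
  weighted mean of the numbers of cliques at the vertices, hence at least the left side; the linear
  family bound caps it by the right side. In the equality case both estimates are tight, and as
  every weight \<open>(x u)\<^sup>2\<close> is positive, each vertex meets its bound.\<close>

lemma
  assumes conn: "Digraph_Component.connected (with_proj G)"
  shows spectral_radius_le:
      "graph_spectral_radius G + of_int \<lceil>real (min_degree G) / (real t - 1)\<rceil>
    \<le> real t + real (card \<Q>) - 1"
    and spectral_radius_eqD:
      "graph_spectral_radius G + of_int \<lceil>real (min_degree G) / (real t - 1)\<rceil>
      = real t + real (card \<Q>) - 1 \<Longrightarrow> {} \<notin> \<Q> \<Longrightarrow>
      (\<forall>v\<in>pverts G. int (card (cliques_at v)) = \<lceil>real (min_degree G) / (real t - 1)\<rceil>) \<and>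
      (\<forall>Q\<in>\<Q>. card Q = t) \<and> (\<forall>Q\<in>\<Q>. \<forall>Q'\<in>\<Q>. Q \<noteq> Q' \<longrightarrow> card (Q \<inter> Q') = 1) \<and> \<Q> \<noteq> {}"
proof -
  let ?V = "pverts G" and ?r = "\<lceil>real (min_degree G) / (real t - 1)\<rceil>"
  define \<rho> where "\<rho> = graph_spectral_radius G"
  obtain x where x: "(\<Sum>u\<in>?V. (x u)\<^sup>2) = 1" "\<And>u. u \<in> ?V \<Longrightarrow> x u > 0"
    and ev: "\<And>u. u \<in> ?V \<Longrightarrow> (\<Sum>v\<in>?V. (if (u, v) \<in> parcs G then 1 else 0) * x v) = \<rho> * x u"
    unfolding \<rho>_def by (rule graph_spectral_radius_perron[OF pair_graph_axioms conn]) blast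
  have "(\<Sum>u\<in>?V. \<Sum>v\<in>?V. (if (u, v) \<in> parcs G then 1 else 0) * x u * x v)
      = (\<Sum>u\<in>?V. x u * (\<Sum>v\<in>?V. (if (u, v) \<in> parcs G then 1 else 0) * x v))"
    by (simp add: sum_distrib_left mult_ac)
  also have "\<dots> = \<rho> * (\<Sum>u\<in>?V. (x u)\<^sup>2)"
    by (simp add: ev power2_eq_square mult.left_commute flip: sum_distrib_left)
  finally have Y: "(\<Sum>Q\<in>\<Q>. (sum x Q)\<^sup>2) = \<rho> + (\<Sum>u\<in>?V. real (card (cliques_at u)) * (x u)\<^sup>2)"
    using sum_clique_squares[of x] x(1) by simp
  have r: "(\<Sum>u\<in>?V. of_int ?r * (x u)\<^sup>2) = real_of_int ?r"
    by (simp add: x(1) flip: sum_distrib_left)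
  have le: "of_int ?r * (x u)\<^sup>2 \<le> real (card (cliques_at u)) * (x u)\<^sup>2" if "u \<in> ?V" for u
    using min_degree_ceiling_le[OF that] by (intro mult_right_mono) (linarith, simp)
  have "(\<Sum>u\<in>?V. of_int ?r * (x u)\<^sup>2) \<le> (\<Sum>u\<in>?V. real (card (cliques_at u)) * (x u)\<^sup>2)"
    by (rule sum_mono) (rule le)
  then have lower: "\<rho> + of_int ?r \<le> (\<Sum>Q\<in>\<Q>. (sum x Q)\<^sup>2)"
    unfolding Y r by simp
  have upper: "(\<Sum>Q\<in>\<Q>. (sum x Q)\<^sup>2) \<le> real t + real (card \<Q>) - 1"
    by (rule linear_family_sum_squares_le[OF pair_finite_verts clique_subset t size card_inter x])
  show "graph_spectral_radius G + of_int ?r \<le> real t + real (card \<Q>) - 1"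
    using lower upper unfolding \<rho>_def by linarith
  assume "graph_spectral_radius G + of_int ?r = real t + real (card \<Q>) - 1" and ne: "{} \<notin> \<Q>"
  then have eq: "(\<Sum>Q\<in>\<Q>. (sum x Q)\<^sup>2) = real t + real (card \<Q>) - 1"
    and eq': "(\<Sum>Q\<in>\<Q>. (sum x Q)\<^sup>2) = \<rho> + of_int ?r"
    using lower upper unfolding \<rho>_def by linarith+
  have "(\<Sum>u\<in>?V. of_int ?r * (x u)\<^sup>2) = (\<Sum>u\<in>?V. real (card (cliques_at u)) * (x u)\<^sup>2)"
    using eq' unfolding Y r by simp
  then have s: "of_int ?r * (x u)\<^sup>2 = real (card (cliques_at u)) * (x u)\<^sup>2" if "u \<in> ?V" for u
    by (rule sum_mono_inv) (auto intro: le pair_finite_verts that)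
  have "int (card (cliques_at u)) = ?r" if "u \<in> ?V" for u
    using s[OF that] x(2)[OF that] by simp
  \<comment> \<open>For an empty partition \<open>eq\<close> would read
    \<open>0 = t - 1\<close>.\<close>
  moreover have "\<Q> \<noteq> {}" using eq t by auto
  moreover have "(\<forall>Q\<in>\<Q>. card Q = t) \<and> (\<forall>Q\<in>\<Q>. \<forall>Q'\<in>\<Q>. Q \<noteq> Q' \<longrightarrow> card (Q \<inter> Q') = 1)"
    by (rule linear_family_sum_squares_eqD[OF pair_finite_verts clique_subset t size card_inter x eq ne])
  ultimately show "(\<forall>v\<in>?V. int (card (cliques_at v)) = ?r) \<and>
      (\<forall>Q\<in>\<Q>. card Q = t) \<and> (\<forall>Q\<in>\<Q>. \<forall>Q'\<in>\<Q>. Q \<noteq> Q' \<longrightarrow> card (Q \<inter> Q') = 1) \<and> \<Q> \<noteq> {}"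
    by blast
qed

end

section \<open>Block graphs of 2-designs\<close>

context bounded_clique_partition
begin

text \<open>A genuine equality of graphs, valid for every such partition: by
  \<open>card_common\<close>, adjacency is sharing exactly one clique.\<close>

lemma eq_block_graph: "G = block_graph (pverts G) cliques_at"
proof -
  have "(u, v) \<in> parcs G \<longleftrightarrow>
      u \<in> pverts G \<and> v \<in> pverts G \<and> u \<noteq> v \<and> card (cliques_at u \<inter> cliques_at v) = 1" for u v
  proof (cases "u = v")
    case True
    then show ?thesis using pair_no_loops[of "(u, v)"] by auto
  next
    case False
    then show ?thesis using card_common[OF False] in_arcsD1[of u v] in_arcsD2[of u v] by auto
  qed
  then have "parcs G = {(u, v). u \<in> pverts G \<and> v \<in> pverts G \<and> u \<noteq> v \<and>
      card (cliques_at u \<inter> cliques_at v) = 1}"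
    by auto
  then show ?thesis by (simp add: block_graph_def)
qed

text \<open>Duality: cliques become points and vertices become blocks. Two cliques meeting in one
  vertex turn into two points on one common block, and the regularity \<open>r\<close> becomes the
  block size.\<close>

lemma regular_dual_design:
  assumes r: "\<And>v. v \<in> pverts G \<Longrightarrow> card (cliques_at v) = r"
    and ct: "\<And>Q. Q \<in> \<Q> \<Longrightarrow> card Q = t"
    and meet: "\<And>Q Q'. Q \<in> \<Q> \<Longrightarrow> Q' \<in> \<Q> \<Longrightarrow> Q \<noteq> Q' \<Longrightarrow> card (Q \<inter> Q') = 1"
    and ne: "\<Q> \<noteq> {}"
  shows "min_degree G = r * (t - 1)" "card \<Q> * t = r * card (pverts G)"
    "steiner_2_design (card \<Q>) r \<Q> (pverts G) cliques_at"
proof -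
  obtain Q v where Q: "Q \<in> \<Q>" and v: "v \<in> Q"
    using ne ct t by (metis all_not_in_conv card.empty not_numeral_le_zero)
  then have vV: "v \<in> pverts G" using clique_subset by auto
  have fin: "finite (cliques_at u)" for u using finite_partition by (simp add: cliques_at_def)
  have deg: "card {w. (u, w) \<in> parcs G} = r * (t - 1)" if "u \<in> pverts G" for u
    using r[OF that] ct by (simp add: degree_eq cliques_at_def)
  have "out_degree (with_proj G) ` pverts G = {r * (t - 1)}"
    using deg vV by (auto simp: out_degree_eq_card)
  then show "min_degree G = r * (t - 1)" by (simp add: min_degree_def)
  show "card \<Q> * t = r * card (pverts G)"
    using double_counting ct r by simp
  have "cliques_at v \<noteq> {}" using Q v by (auto simp: cliques_at_def)
  then have r1: "r \<ge> 1" using r[OF vV] fin[of v] by (metis One_nat_def Suc_leI card_gt_0_iff)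
  have meetE: "\<exists>w. Q \<inter> Q' = {w}" if "Q \<in> \<Q>" "Q' \<in> \<Q>" "Q \<noteq> Q'" for Q Q'
    using meet[OF that] by (simp add: card_1_singleton_iff)
  \<comment> \<open>Two different cliques would share a vertex, which would then lie on at least two
    cliques. This is the degenerate design in which blocks may repeat.\<close>
  have single: "card \<Q> = 1" if "r = 1"
  proof -
    have "\<Q> = {Q}"
    proof (rule ccontr)
      assume "\<Q> \<noteq> {Q}"
      then obtain Q' where Q': "Q' \<in> \<Q>" "Q \<noteq> Q'" using Q by blast
      then obtain w where w: "Q \<inter> Q' = {w}" using meetE Q by blast
      then have "{Q, Q'} \<subseteq> cliques_at w" using Q Q' by (auto simp: cliques_at_def)
      then have "card {Q, Q'} \<le> card (cliques_at w)" by (intro card_mono fin)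
      moreover have "w \<in> pverts G" using w Q clique_subset by auto
      ultimately show False using r Q' that by simp
    qed
    then show ?thesis by simp
  qed
  \<comment> \<open>With \<open>r \<ge> 2\<close>, two cliques through \<open>u\<close> determine
    \<open>u\<close>, since they have no second common vertex.\<close>
  have inj: "inj_on cliques_at (pverts G)" if "r \<noteq> 1"
  proof (rule inj_onI)
    fix u w assume u: "u \<in> pverts G" and eq: "cliques_at u = cliques_at w"
    have "\<not> card (cliques_at u) \<le> Suc 0" using r[OF u] r1 that by simp
    then obtain Q Q' where "Q \<in> cliques_at u" "Q' \<in> cliques_at u" "Q \<noteq> Q'"
      using fin by (auto simp: card_le_Suc0_iff_eq)
    then show "u = w" using eq clique_unique unfolding cliques_at_def by blast
  qed
  show "steiner_2_design (card \<Q>) r \<Q> (pverts G) cliques_at"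
  proof
    show "\<exists>!i. i \<in> pverts G \<and> Q \<in> cliques_at i \<and> Q' \<in> cliques_at i"
      if Q: "Q \<in> \<Q>" "Q' \<in> \<Q>" "Q \<noteq> Q'" for Q Q'
    proof -
      obtain w where "Q \<inter> Q' = {w}" using meetE Q by blast
      with Q clique_subset show ?thesis unfolding cliques_at_def
        by (intro ex1I[of _ w]) blast+
    qed
    show "inj_on cliques_at (pverts G) \<or> card \<Q> = 1 \<and> r = 1"
      using inj single by blast
  qed (use r r1 ne finite_partition pair_finite_verts in
      \<open>auto simp: cliques_at_def Suc_le_eq card_gt_0_iff\<close>)
qed

end

text \<open>Relabelling along \<open>g\<close> on points and \<open>f\<close> on block indices, with
  \<open>f\<close> going from new to old indices. It moves the dual design, made of cliques and
  vertices, to natural numbers.\<close>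

lemma steiner_2_design_transfer:
  assumes D: "steiner_2_design v k P I B" and g: "inj_on g P" and f: "bij_betw f J I"
  shows "steiner_2_design v k (g ` P) J (\<lambda>j. g ` B (f j))"
proof -
  interpret steiner_2_design v k P I B by fact
  have fJ: "f j \<in> I" if "j \<in> J" for j using f that by (auto simp: bij_betw_def)
  have mem: "g x \<in> g ` B (f j) \<longleftrightarrow> x \<in> B (f j)" if "j \<in> J" "x \<in> P" for x j
    using block_points[OF fJ[OF that(1)]] that(2) g by (auto dest: inj_onD)
  show ?thesis
  proof
    show "card (g ` P) = v" using card_points g by (simp add: card_image)
    show "finite J" using finite_blocks bij_betw_finite[OF f] by simp
    show "g ` B (f j) \<subseteq> g ` P" if "j \<in> J" for j
      using block_points fJ[OF that] by blast
    show "card (g ` B (f j)) = k" if "j \<in> J" for j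
      using card_block block_points fJ[OF that] g by (metis card_image inj_on_subset)
    show "\<exists>!j. j \<in> J \<and> x \<in> g ` B (f j) \<and> y \<in> g ` B (f j)"
      if xy: "x \<in> g ` P" "y \<in> g ` P" "x \<noteq> y" for x y
    proof -
      obtain p q where pq: "p \<in> P" "q \<in> P" "x = g p" "y = g q" using xy by blast
      then obtain i where i: "i \<in> I" "p \<in> B i" "q \<in> B i"
        and u: "\<And>i'. i' \<in> I \<Longrightarrow> p \<in> B i' \<Longrightarrow> q \<in> B i' \<Longrightarrow> i' = i"
        using unique_block[of p q] xy(3) by blast
      obtain j where j: "j \<in> J" "f j = i" using i(1) f by (auto simp: bij_betw_def)
      show ?thesis
      proof (rule ex1I[of _ j])
        show "j \<in> J \<and> x \<in> g ` B (f j) \<and> y \<in> g ` B (f j)" using i j pq by auto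
        fix j' assume "j' \<in> J \<and> x \<in> g ` B (f j') \<and> y \<in> g ` B (f j')"
        then have "j' \<in> J" "p \<in> B (f j')" "q \<in> B (f j')"
          using mem[of j' p] mem[of j' q] pq by auto
        then have "f j' = i" using u fJ by blast
        then show "j' = j" using \<open>j' \<in> J\<close> j f by (auto simp: bij_betw_def dest: inj_onD)
      qed
    qed
    show "inj_on (\<lambda>j. g ` B (f j)) J \<or> v = 1 \<and> k = 1"
    proof (cases "inj_on B I")
      case True
      have "inj_on (\<lambda>j. g ` B (f j)) J"
      proof (rule inj_onI)
        fix i j assume ij: "i \<in> J" "j \<in> J" "g ` B (f i) = g ` B (f j)"
        then have "B (f i) = B (f j)"
          using inj_on_image_eq_iff[OF g] block_points fJ by blast
        then show "i = j" using True f ij fJ by (auto simp: bij_betw_def dest: inj_onD)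
      qed
      then show ?thesis ..
    qed (use no_repeated_blocks in blast)
  qed (use finite_points v_pos k_pos in auto)
qed

text \<open>An injective renaming of points preserves the sizes of intersections of blocks, so
  \<open>f\<close> itself is the isomorphism.\<close>

lemma block_graph_transfer:
  assumes g: "inj_on g P" and f: "bij_betw f J I" and B: "\<And>i. i \<in> I \<Longrightarrow> B i \<subseteq> P"
  shows "digraph_iso (with_proj (block_graph J (\<lambda>j. g ` B (f j)))) (with_proj (block_graph I B))"
proof -
  have fJ: "f j \<in> I" if "j \<in> J" for j using f that by (auto simp: bij_betw_def)
  have "card (g ` B (f i) \<inter> g ` B (f j)) = card (B (f i) \<inter> B (f j))" if "i \<in> J" "j \<in> J" for i j
  proof -
    have s: "B (f i) \<subseteq> P" "B (f j) \<subseteq> P" using B fJ that by blast+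
    then have "g ` B (f i) \<inter> g ` B (f j) = g ` (B (f i) \<inter> B (f j))"
      using inj_on_image_Int[OF g] by simp
    moreover have "inj_on g (B (f i) \<inter> B (f j))" using g s by (blast intro: inj_on_subset)
    ultimately show ?thesis by (simp add: card_image)
  qed
  moreover have "f i = f j \<longleftrightarrow> i = j" if "i \<in> J" "j \<in> J" for i j
    using f that by (auto simp: bij_betw_def dest: inj_onD)
  ultimately have "\<forall>i\<in>J. \<forall>j\<in>J. (i, j) \<in> parcs (block_graph J (\<lambda>j. g ` B (f j)))
      \<longleftrightarrow> (f i, f j) \<in> parcs (block_graph I B)"
    using fJ by (auto simp: block_graph_def)
  then show ?thesis
    unfolding digraph_iso_with_proj_iff[OF pair_wf_digraph_block_graph pair_wf_digraph_block_graph]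
    using f by (intro exI[of _ f]) (simp add: block_graph_def)
qed

section \<open>Replication numbers and the cliques of a block graph\<close>

context steiner_2_design
begin

definition replication :: "'p \<Rightarrow> nat" where
  "replication p = card {i \<in> I. p \<in> B i}"

lemma finite_block: "i \<in> I \<Longrightarrow> finite (B i)"
  using block_points finite_points finite_subset by blast

lemma sum_replication: "(\<Sum>p\<in>P. replication p) = card I * k"
proof -
  have "(\<Sum>p\<in>P. replication p) = (\<Sum>p\<in>P. \<Sum>i\<in>I. of_bool (p \<in> B i))"
    using finite_blocks by (simp add: replication_def sum_of_bool_eq Int_def)
  also have "\<dots> = (\<Sum>i\<in>I. \<Sum>p\<in>P. of_bool (p \<in> B i))" by (rule sum.swap)
  also have "\<dots> = (\<Sum>i\<in>I. card (B i))"
    using finite_points block_points by (intro sum.cong) (simp_all add: sum_of_bool_eq Int_absorb1)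
  finally show ?thesis using card_block by simp
qed

lemma block_eqI:
  assumes "i \<in> I" "j \<in> I" "x \<in> B i" "y \<in> B i" "x \<in> B j" "y \<in> B j" "x \<noteq> y"
  shows "i = j"
proof -
  have "x \<in> P" "y \<in> P" using assms(1,3,4) block_points by blast+
  then show ?thesis using unique_block[of x y] assms by blast
qed

text \<open>The blocks through \<open>p\<close>, with \<open>p\<close> removed, partition the
  remaining points.\<close>

lemma replication_mult:
  assumes p: "p \<in> P"
  shows "replication p * (k - 1) = v - 1"
proof -
  have "P - {p} = (\<Union>i\<in>{i \<in> I. p \<in> B i}. B i - {p})"
  proof (intro equalityI subsetI)
    fix q assume "q \<in> P - {p}"
    then show "q \<in> (\<Union>i\<in>{i \<in> I. p \<in> B i}. B i - {p})"
      using unique_block[OF p, of q] by auto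
  qed (use block_points in auto)
  moreover have "card (\<Union>i\<in>{i \<in> I. p \<in> B i}. B i - {p}) = (\<Sum>i\<in>{i \<in> I. p \<in> B i}. card (B i - {p}))"
  proof (rule card_UN_disjoint)
    show "\<forall>i\<in>{i \<in> I. p \<in> B i}. \<forall>j\<in>{i \<in> I. p \<in> B i}. i \<noteq> j \<longrightarrow> (B i - {p}) \<inter> (B j - {p}) = {}"
      using block_eqI[of _ _ p] by auto
  qed (use finite_blocks finite_block in auto)
  moreover have "card (P - {p}) = v - 1" using p card_points by simp
  ultimately show ?thesis
    using card_block finite_block by (simp add: replication_def)
qed

text \<open>Summing \<open>replication_mult\<close> over the points and counting incidences gives
  \<open>v * (v - 1) = card I * k * (k - 1)\<close>; the hypothesis turns the right side into
  \<open>v * (t * (k - 1))\<close>, and \<open>v\<close> cancels.\<close>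

lemma replication_eq:
  assumes vt: "v * t = k * card I"
  shows "v - 1 = t * (k - 1)" "p \<in> P \<Longrightarrow> replication p = t"
proof -
  have "v * (v - 1) = (\<Sum>p\<in>P. replication p * (k - 1))"
    using replication_mult card_points by simp
  also have "\<dots> = card I * k * (k - 1)"
    by (simp flip: sum_distrib_right add: sum_replication)
  also have "\<dots> = v * (t * (k - 1))" using vt by (simp add: mult_ac)
  finally show v: "v - 1 = t * (k - 1)" using v_pos by simp
  assume p: "p \<in> P"
  show "replication p = t"
  proof (cases "k = 1")
    \<comment> \<open>For \<open>k = 1\<close> both sides of \<open>replication_mult\<close> vanish,
      so the value is obtained from the incidence count at the only point.\<close>
    case True
    then have "v = 1" using v v_pos by simp
    then have "P = {p}" using card_points p by (auto simp: card_1_singleton_iff)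
    then show ?thesis using sum_replication vt True \<open>v = 1\<close> by simp
  next
    case False
    then show ?thesis using replication_mult[OF p] v k_pos by simp
  qed
qed

lemma blocks_meet:
  assumes "i \<in> I" "j \<in> I" "i \<noteq> j" "p \<in> B i" "p \<in> B j"
  shows "B i \<inter> B j = {p}"
  using assms block_eqI[of i j p] by blast

end

text \<open>Each point yields the clique of all blocks through it. Adjacent blocks meet in a single
  point, so these cliques partition the edges, and there are at most \<open>v\<close> of
  them.\<close>

lemma cp_le_block_graph:
  fixes G :: "'a pair_pre_digraph"
  assumes G: "pair_wf_digraph G" and D: "steiner_2_design v k P I B"
    and iso: "digraph_iso (with_proj G) (with_proj (block_graph I B))"
    and vt: "v * t = k * card (pverts G)"
  shows "cp t G \<le> v" "v - 1 = t * (k - 1)"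
proof -
  interpret steiner_2_design v k P I B by fact
  obtain f where bij: "bij_betw f (pverts G) I"
    and arcs: "\<And>u w. u \<in> pverts G \<Longrightarrow> w \<in> pverts G \<Longrightarrow>
      (u, w) \<in> parcs G \<longleftrightarrow> f u \<noteq> f w \<and> card (B (f u) \<inter> B (f w)) = 1"
    using iso unfolding digraph_iso_with_proj_iff[OF G pair_wf_digraph_block_graph]
    by (auto simp: block_graph_def bij_betw_def)
  have fI: "f u \<in> I" if "u \<in> pverts G" for u using bij that by (auto simp: bij_betw_def)
  have f_eq: "f u = f w \<longleftrightarrow> u = w" if "u \<in> pverts G" "w \<in> pverts G" for u w
    using bij that by (auto simp: bij_betw_def dest: inj_onD)
  have vt': "v * t = k * card I" using vt bij_betw_same_card[OF bij] by simp
  then show "v - 1 = t * (k - 1)" by (rule replication_eq)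
  \<comment> \<open>The clique of \<open>p\<close>, pulled back to \<open>G\<close>; its size is the
    replication number \<open>t\<close>.\<close>
  define K where "K p = {u \<in> pverts G. p \<in> B (f u)}" for p
  have "card (K p) = t" if "p \<in> P" for p
  proof -
    have "f ` K p = {i \<in> I. p \<in> B i}" using bij by (auto simp: bij_betw_def K_def)
    moreover have "inj_on f (K p)" using bij by (auto simp: bij_betw_def K_def inj_on_def)
    ultimately have "card (K p) = replication p" by (metis card_image replication_def)
    then show ?thesis using replication_eq(2)[OF vt' that] by simp
  qed
  then have size: "\<forall>Q\<in>K ` P. card Q \<le> t" by auto
  have "clique G (K p)" for p
    unfolding clique_def using blocks_meet fI f_eq by (auto simp: K_def arcs)
  moreover have "\<exists>!Q. Q \<in> K ` P \<and> u \<in> Q \<and> w \<in> Q" if e: "(u, w) \<in> parcs G" for u w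
  proof -
    have uw: "u \<in> pverts G" "w \<in> pverts G"
      using e pair_wf_digraph.in_arcsD1[OF G] pair_wf_digraph.in_arcsD2[OF G] by blast+
    then obtain p where p: "B (f u) \<inter> B (f w) = {p}"
      using e by (auto simp: arcs card_1_singleton_iff)
    then have "p \<in> P" using block_points fI uw by blast
    with p uw show ?thesis by (intro ex1I[of _ "K p"]) (auto simp: K_def)
  qed
  ultimately have "clique_partition G (K ` P)"
    by (intro clique_partitionI) auto
  then have "cp t G \<le> card (K ` P)"
    unfolding cp_def using size by (intro Least_le) blast
  also have "\<dots> \<le> v" using card_image_le[OF finite_points] card_points by simp
  finally show "cp t G \<le> v" .
qed

text \<open>The edges, as cliques of two vertices, form an admissible partition because
  \<open>t \<ge> 2\<close>, so the least size is attained. Minimality excludes the empty clique, as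
  the equality analysis requires.\<close>

lemma cp_attained:
  assumes "pair_graph G" and t: "t \<ge> 2"
  obtains \<Q> where "bounded_clique_partition G t \<Q>" "card \<Q> = cp t G" "{} \<notin> \<Q>"
proof -
  interpret pair_graph G by fact
  have sym: "(v, u) \<in> parcs G" if "(u, v) \<in> parcs G" for u v
    using that pair_sym_arcs by (auto simp: symmetric_def sym_def)
  define E where "E = {{u, v} | u v. (u, v) \<in> parcs G}"
  have "clique G Q" if "Q \<in> E" for Q
    using that sym in_arcsD1 in_arcsD2 unfolding E_def clique_def by auto
  moreover have "\<exists>!Q. Q \<in> E \<and> u \<in> Q \<and> v \<in> Q" if e: "(u, v) \<in> parcs G" for u v
  proof (rule ex1I[of _ "{u, v}"])
    show "Q = {u, v}" if "Q \<in> E \<and> u \<in> Q \<and> v \<in> Q" for Q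
      using that pair_no_loops[OF e] by (auto simp: E_def)
  qed (use e in \<open>auto simp: E_def\<close>)
  ultimately have "clique_partition G E"
    by (rule clique_partitionI)
  moreover have "\<forall>Q\<in>E. card Q \<le> t"
    using t by (auto simp: E_def card_insert_if)
  ultimately have "\<exists>m \<Q>. clique_partition G \<Q> \<and> (\<forall>Q\<in>\<Q>. card Q \<le> t) \<and> card \<Q> = m" by blast
  then have "\<exists>\<Q>. clique_partition G \<Q> \<and> (\<forall>Q\<in>\<Q>. card Q \<le> t) \<and> card \<Q> = cp t G"
    unfolding cp_def by (rule LeastI_ex)
  then obtain \<Q> where Q: "clique_partition G \<Q>" "\<forall>Q\<in>\<Q>. card Q \<le> t" "card \<Q> = cp t G" by blast
  interpret bounded_clique_partition G t \<Q> by unfold_locales (use Q t in auto)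
  have "{} \<notin> \<Q>"
  proof
    assume "{} \<in> \<Q>"
    have "clique_partition G (\<Q> - {{}})"
    proof -
      \<comment> \<open>A clique containing the ends of an edge is nonempty, so deleting the empty
        set does not affect the covering condition.\<close>
      have "Q \<in> \<Q> - {{}} \<and> u \<in> Q \<and> v \<in> Q \<longleftrightarrow> Q \<in> \<Q> \<and> u \<in> Q \<and> v \<in> Q" for Q u v by auto
      then show ?thesis using Q(1) unfolding clique_partition_def by (simp only:) blast
    qed
    then have "cp t G \<le> card (\<Q> - {{}})"
      unfolding cp_def using Q(2) by (intro Least_le) blast
    moreover have "card (\<Q> - {{}}) < card \<Q>"
      using \<open>{} \<in> \<Q>\<close> finite_partition by (rule card_Diff1_less[rotated])
    ultimately show False using Q(3) by simp
  qed
  with that bounded_clique_partition_axioms Q(3) show ?thesis by blast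
qed

theorem theorem3p1:
  fixes G :: "'a pair_pre_digraph" and t :: nat
  assumes "t \<ge> 2"
    and "pair_graph G"
    and "Digraph_Component.connected (with_proj G)"
  shows "real (cp t G) \<ge> graph_spectral_radius G - real t + 1
             + real_of_int \<lceil>real (min_degree G) / (real t - 1)\<rceil>
       \<and> (real (cp t G) = graph_spectral_radius G - real t + 1
             + real_of_int \<lceil>real (min_degree G) / (real t - 1)\<rceil>
          \<longleftrightarrow> (\<exists>(v::nat) (k::nat) (P::nat set) (I::nat set) (B::nat \<Rightarrow> nat set).
                 real k = real (min_degree G) / (real t - 1)
               \<and> real v = real k * real (card (pverts G)) / real t
               \<and> steiner_2_design v k P I B
               \<and> digraph_iso (with_proj G) (with_proj (block_graph I B))))"
    (is "?lower \<and> (?eq \<longleftrightarrow> ?design)")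
proof -
  let ?r = "\<lceil>real (min_degree G) / (real t - 1)\<rceil>"
  obtain \<Q> where Q: "bounded_clique_partition G t \<Q>" "card \<Q> = cp t G" "{} \<notin> \<Q>"
    using cp_attained assms(1,2) by blast
  interpret bounded_clique_partition G t \<Q> by fact
  have lower: ?lower using spectral_radius_le[OF assms(3)] Q(2) by simp
  have ?design if ?eq
  proof -
    have eq: "graph_spectral_radius G + of_int ?r = real t + real (card \<Q>) - 1"
      using that Q(2) by simp
    note tight = spectral_radius_eqD[OF assms(3) eq Q(3)]
    \<comment> \<open>The ceiling is the number of cliques at each vertex, so \<open>nat\<close>
      loses nothing. Below, \<open>min_degree G = k * (t - 1)\<close> shows that the quotient was
      already an integer.\<close>
    define k where "k = nat ?r"
    have reg: "card (cliques_at v) = k" if "v \<in> pverts G" for v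
      using tight that unfolding k_def by (metis nat_int)
    have ct: "card Q = t" if "Q \<in> \<Q>" for Q
      using tight that by blast
    have meet: "card (Q \<inter> Q') = 1" if "Q \<in> \<Q>" "Q' \<in> \<Q>" "Q \<noteq> Q'" for Q Q'
      using tight that by blast
    have ne: "\<Q> \<noteq> {}" using tight by blast
    note k = regular_dual_design(1,2)[OF reg ct meet ne]
    note design = regular_dual_design(3)[OF reg ct meet ne]
    \<comment> \<open>The design is to live on natural numbers: \<open>g\<close> encodes the cliques
      as points, and \<open>h\<close> numbers the vertices as block indices.\<close>
    obtain g :: "'a set \<Rightarrow> nat" where g: "inj_on g \<Q>"
      using finite_imp_inj_to_nat_seg[OF finite_partition] by blast
    obtain h :: "nat \<Rightarrow> 'a" where h: "bij_betw h {0..<card (pverts G)} (pverts G)"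
      using ex_bij_betw_nat_finite[OF pair_finite_verts] by blast
    let ?I = "{0..<card (pverts G)}" and ?B = "\<lambda>j. g ` cliques_at (h j)"
    interpret H: pair_wf_digraph "block_graph ?I ?B" by (rule pair_wf_digraph_block_graph)
    have "digraph_iso (with_proj (block_graph ?I ?B)) (with_proj G)"
      using block_graph_transfer[OF g h, of cliques_at] eq_block_graph by (auto simp: cliques_at_def)
    then have "digraph_iso (with_proj G) (with_proj (block_graph ?I ?B))"
      by (rule digraph_iso_swap[OF H.wf_digraph_axioms])
    moreover have "real k = real (min_degree G) / (real t - 1)"
      using t k(1) by (simp add: of_nat_diff)
    moreover have "real (card \<Q>) = real k * real (card (pverts G)) / real t"
      using t k(2) by (simp add: eq_divide_eq flip: of_nat_mult)
    ultimately show ?thesis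
      using steiner_2_design_transfer[OF design g h] by blast
  qed
  moreover have ?eq if ?design
  proof -
    obtain v k and P I :: "nat set" and B where k: "real k = real (min_degree G) / (real t - 1)"
      and v: "real v = real k * real (card (pverts G)) / real t"
      and D: "steiner_2_design v k P I B"
      and iso: "digraph_iso (with_proj G) (with_proj (block_graph I B))"
      using \<open>?design\<close> by blast
    \<comment> \<open>The two real equations are turned into the count
      \<open>v * t = k * card (pverts G)\<close>, the form in which the design lemmas use
      them.\<close>
    have "real (v * t) = real (k * card (pverts G))" using v t by simp
    then have vt: "v * t = k * card (pverts G)" by (simp only: of_nat_eq_iff)
    note cp = cp_le_block_graph[OF pair_wf_digraph_axioms D iso vt]
    have "v \<ge> 1" "k \<ge> 1" using D by (simp_all add: steiner_2_design_def)
    then have "real v = real t * (real k - 1) + 1"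
      using arg_cong[OF cp(2), of real] by (simp add: of_nat_diff)
    moreover have "real k * (real t - 1) \<le> graph_spectral_radius G"
      using min_degree_le_spectral_radius[OF assms(2,3)] k t by (simp add: field_simps)
    moreover have "real_of_int ?r = real k" by (simp flip: k)
    \<comment> \<open>With ceiling \<open>k\<close> and spectral radius at least
      \<open>k * (t - 1)\<close>, the right side of the bound is at least
      \<open>k * (t - 1) - t + 1 + k = t * (k - 1) + 1 = v\<close>, hence at least
      \<open>cp t G\<close>; \<open>lower\<close> is the reverse inequality.\<close>
    ultimately show ?eq using cp(1) lower by (simp add: algebra_simps)
  qed
  ultimately show ?thesis using lower by blast
qed

end
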